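(* Assume that the Cantor space $2^\omega$ cannot be covered by $\aleph_1$ meager sets, and that there is a Michael space. Then every productively Lindelöf $\aleph_1$-analytic subset of the Cantor space (with the subspace topology) is $\sigma$-compact.
   Context: For an uncountable cardinal $\kappa$, a $T_2$ space is $\kappa$-analytic if it is a continuous image of the product of $\aleph_0$ copies of the discrete space of cardinality $\kappa$. A topological space is productively Lindelöf if its product with every Lindelöf space is Lindelöf. A Michael space is a Lindelöf space $M$ such that $M\times\mathbb{P}$ is not Lindelöf, where $\mathbb{P}$ is the space of irrational numbers. *)

theory Defs
  imports "HOL-Analysis.Analysis"
begin

unbundle cardinal_syntax

abbreviation aleph1 :: "nat set rel" where
  "aleph1 \<equiv> cardSuc natLeq"

definition cantor_space :: "(nat \<Rightarrow> bool) topology" where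
  "cantor_space = product_topology (\<lambda>_. discrete_topology (UNIV :: bool set)) (UNIV :: nat set)"

definition irrationals :: "real topology" where
  "irrationals = top_of_set (- \<rat>)"

definition nowhere_dense_in :: "'a topology \<Rightarrow> 'a set \<Rightarrow> bool" where
  "nowhere_dense_in X S \<longleftrightarrow> S \<subseteq> topspace X \<and> X interior_of (X closure_of S) = {}"

definition meager_in :: "'a topology \<Rightarrow> 'a set \<Rightarrow> bool" where
  "meager_in X S \<longleftrightarrow> S \<subseteq> topspace X \<and>
     (\<exists>N :: nat \<Rightarrow> 'a set. (\<forall>n. nowhere_dense_in X (N n)) \<and> S \<subseteq> (\<Union>n. N n))"

definition Michael_space :: "'a topology \<Rightarrow> bool" where
  "Michael_space M \<longleftrightarrow> Lindelof_space M \<and> \<not> Lindelof_space (prod_topology M irrationals)"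

definition productively_Lindelof :: "'b itself \<Rightarrow> 'a topology \<Rightarrow> bool" where
  "productively_Lindelof (ty :: 'b itself) X \<longleftrightarrow>
     (\<forall>Y :: 'b topology. Lindelof_space Y \<longrightarrow> Lindelof_space (prod_topology X Y))"

definition kappa_analytic_via :: "'k set \<Rightarrow> 'a topology \<Rightarrow> bool" where
  "kappa_analytic_via K X \<longleftrightarrow> Hausdorff_space X \<and>
     (\<exists>f. continuous_map (product_topology (\<lambda>_. discrete_topology K) (UNIV :: nat set)) X f \<and>
          f ` topspace (product_topology (\<lambda>_. discrete_topology K) (UNIV :: nat set)) = topspace X)"

definition aleph1_analytic :: "'k itself \<Rightarrow> 'a topology \<Rightarrow> bool" where
  "aleph1_analytic (ty :: 'k itself) X \<longleftrightarrow>
     (\<exists>K :: 'k set. |K| =o aleph1 \<and> kappa_analytic_via K X)"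

definition sigma_compact_in :: "'a topology \<Rightarrow> 'a set \<Rightarrow> bool" where
  "sigma_compact_in X S \<longleftrightarrow> (\<exists>C :: nat \<Rightarrow> 'a set. (\<forall>n. compactin X (C n)) \<and> S = (\<Union>n. C n))"

end

theory Submission
  imports Defs
begin

text \<open>
  Let \<open>X\<close> be the image of \<open>K\<^sup>\<omega>\<close> under a continuous \<open>f\<close>, with \<open>|K| = \<aleph>\<^sub>1\<close>.
  First, a Hurewicz-type dichotomy: either \<open>X\<close> is a union of \<open>\<aleph>\<^sub>1\<close> compact sets, or \<open>X\<close> has a
  continuous map into \<open>\<omega>\<^sup>\<omega>\<close> whose range is pointwise dominating. In the second case the irrationals
  are the projection of a closed subset of \<open>X \<times> \<real>\<close> (a dominating function bounds
  the distances to the rationals from below), so that \<open>M \<times> \<P>\<close> would be Lindelof for every Michael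
  space \<open>M\<close>.

  In the first case the covering hypothesis shows that every compact subset of \<open>X\<close> is covered by
  countably many of the \<open>\<aleph>\<^sub>1\<close> compact sets. If \<open>X\<close> itself were not, a recursion of length \<open>\<omega>\<^sub>1\<close> would
  give an uncountable \<open>S \<subseteq> X\<close> that meets every compact subset of \<open>X\<close> in a countable set. Isolating the
  points of \<open>S\<close> in \<open>(2\<^sup>\<omega> - X) \<union> S\<close> yields a Lindelof space whose product with \<open>X\<close> has the uncountable
  closed discrete subset \<open>{(s, s) | s \<in> S}\<close>.
\<close>

section \<open>Lindelof products\<close>

text \<open>Compactness of \<open>Y\<close> makes the projection to \<open>X\<close> proper (closed,
  with compact fibres), and the Lindelof property pulls back along proper maps.\<close>

lemma Lindelof_space_prod_compact:
  assumes "Lindelof_space X" "compact_space Y"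
  shows "Lindelof_space (prod_topology X Y)"
proof (rule Lindelof_space_proper_map_preimage)
  show "proper_map (prod_topology X Y) X fst"
    unfolding proper_map_def
  proof (intro conjI ballI)
    show "closed_map (prod_topology X Y) X fst"
      by (simp add: assms closed_map_fst)
    fix x assume x: "x \<in> topspace X"
    have "{p \<in> topspace (prod_topology X Y). fst p = x} = {x} \<times> topspace Y"
      using x by auto
    moreover have "compactin (prod_topology X Y) ({x} \<times> topspace Y)"
      using x assms by (simp add: compactin_Times compact_space_def)
    ultimately show "compactin (prod_topology X Y) {p \<in> topspace (prod_topology X Y). fst p = x}"
      by simp
  qed
qed (fact assms)

text \<open>The line is the union of the compact intervals from \<open>- real n\<close> to
  \<open>real n\<close>, so the product is a countable union of Lindelof slabs.\<close>

lemma Lindelof_space_prod_real: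
  assumes "Lindelof_space X"
  shows "Lindelof_space (prod_topology X (euclidean :: real topology))"
proof -
  let ?P = "prod_topology X (euclidean :: real topology)"
  let ?U = "range (\<lambda>n::nat. UNIV \<times> {- real n .. real n}) :: ('a \<times> real) set set"
  have "Lindelof_space (subtopology ?P (\<Union>?U))"
  proof (rule Lindelof_space_Union)
    fix U assume "U \<in> ?U"
    then obtain n :: nat where U: "U = UNIV \<times> {- real n .. real n}" by auto
    have "subtopology ?P U = prod_topology X (top_of_set {- real n .. real n})"
      unfolding U by (simp add: subtopology_Times)
    moreover have "compact_space (top_of_set {- real n .. real n})"
      by (simp add: compact_space_subtopology)
    ultimately show "Lindelof_space (subtopology ?P U)"
      by (simp add: Lindelof_space_prod_compact assms)
  qed auto
  moreover have "p \<in> \<Union>?U" for p :: "'a \<times> real"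
  proof -
    obtain n :: nat where "\<bar>snd p\<bar> \<le> real n"
      using real_arch_simple by blast
    then have "p \<in> UNIV \<times> {- real n .. real n}"
      by (auto simp: mem_Times_iff)
    then show ?thesis by (rule UnionI[OF rangeI])
  qed
  then have "\<Union>?U = UNIV"
    by (simp only: set_eq_iff UNIV_I simp_thms)
  ultimately show ?thesis
    by (simp only: subtopology_UNIV)
qed

section \<open>Transporting test spaces between types\<close>

lemma homeomorphic_Lindelof_space:
  assumes "X homeomorphic_space Y"
  shows "Lindelof_space X \<longleftrightarrow> Lindelof_space Y"
proof -
  have "Lindelof_space Y" if "X homeomorphic_space Y" "Lindelof_space X"
    for X :: "'c topology" and Y :: "'d topology"
    using that Lindelof_space_quotient_map_image unfolding homeomorphic_space homeomorphic_map_def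
    by blast
  from this[OF assms] this[OF assms[unfolded homeomorphic_space_sym[of X]]] show ?thesis
    by blast
qed

text \<open>Productive Lindelofness quantifies over test spaces on one fixed type. A space on
  another type is carried there along an injection, with the topology pulled back along the inverse
  map.\<close>

lemma homeomorphic_copy:
  fixes h :: "'a \<Rightarrow> 'b"
  assumes inj: "inj_on h (topspace Y)"
  obtains Y' :: "'b topology" where "Y homeomorphic_space Y'"
proof -
  define g where "g = inv_into (topspace Y) h"
  define Y' where "Y' = pullback_topology (h ` topspace Y) g Y"
  have gh: "g (h x) = x" if "x \<in> topspace Y" for x
    using that inj by (simp add: g_def)
  have top: "topspace Y' = h ` topspace Y"
    unfolding Y'_def topspace_pullback_topology by (auto simp: gh)
  have "homeomorphic_maps Y Y' h g"
    unfolding homeomorphic_maps_def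
  proof (intro conjI ballI)
    show "continuous_map Y' Y g"
      unfolding Y'_def using continuous_map_pullback[of Y Y id "h ` topspace Y" g] by simp
    show "continuous_map Y Y' h"
      unfolding Y'_def
    proof (rule continuous_map_pullback')
      show "continuous_map Y Y (g \<circ> h)"
        by (rule continuous_map_eq[of Y Y id]) (auto simp: gh)
    qed auto
  qed (auto simp: top gh)
  then show thesis
    using that homeomorphic_space_def by blast
qed

lemma productively_Lindelof_prod:
  fixes Y :: "'c topology" and h :: "'c \<Rightarrow> 'b"
  assumes X: "productively_Lindelof TYPE('b) X"
    and Y: "Lindelof_space Y" and inj: "inj_on h (topspace Y)"
  shows "Lindelof_space (prod_topology X Y)"
proof -
  obtain Y' :: "'b topology" where Y': "Y homeomorphic_space Y'"
    using homeomorphic_copy[OF inj] by blast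
  then have "Lindelof_space (prod_topology X Y')"
    using X Y homeomorphic_Lindelof_space unfolding productively_Lindelof_def by blast
  moreover have "prod_topology X Y homeomorphic_space prod_topology X Y'"
    using Y' by (simp add: homeomorphic_space_prod_topology homeomorphic_space_refl)
  ultimately show ?thesis
    using homeomorphic_Lindelof_space by blast
qed

section \<open>The Cantor space\<close>

lemma cantor_space_euclidean: "cantor_space = euclidean"
proof -
  have "discrete_topology (UNIV :: bool set) = euclidean"
    by (simp add: topology_eq open_discrete flip: open_openin)
  then show ?thesis
    by (simp add: cantor_space_def euclidean_product_topology)
qed

lemma Hausdorff_cantor_space: "Hausdorff_space cantor_space"
  by (simp add: cantor_space_def Hausdorff_space_product_topology Hausdorff_space_discrete_topology)

text \<open>Makes \<open>nat \<Rightarrow> bool\<close> second countable, so that arbitrary families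
  of open sets there have countable subfamilies with the same union.\<close>

instance bool :: second_countable_topology
proof
  show "\<exists>B :: bool set set. countable B \<and> open = generate_topology B"
    by (intro exI[of _ UNIV] conjI)
      (auto simp: fun_eq_iff open_discrete intro: generate_topology.Basis)
qed

text \<open>A basic open set restricts finitely many coordinates, hence only coordinates below some
  \<open>n\<close>; so initial segments give a neighbourhood base, and topology becomes
  combinatorics of finite sequences.\<close>

lemma openin_product_discrete_iff:
  "openin (product_topology (\<lambda>_. discrete_topology K) (UNIV :: nat set)) U \<longleftrightarrow>
     U \<subseteq> (UNIV \<rightarrow> K) \<and> (\<forall>x\<in>U. \<exists>n. \<forall>y\<in>UNIV \<rightarrow> K. (\<forall>i<n. y i = x i) \<longrightarrow> y \<in> U)"
    (is "openin ?P U \<longleftrightarrow> ?rhs")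
proof
  assume U: "openin ?P U"
  have "U \<subseteq> UNIV \<rightarrow> K"
    using openin_subset[OF U] by (auto simp: PiE_UNIV_domain)
  moreover have "\<exists>n. \<forall>y\<in>UNIV \<rightarrow> K. (\<forall>i<n. y i = x i) \<longrightarrow> y \<in> U" if "x \<in> U" for x
  proof -
    from U \<open>x \<in> U\<close> obtain W where W: "finite {i. W i \<noteq> K}" "x \<in> Pi\<^sub>E UNIV W" "Pi\<^sub>E UNIV W \<subseteq> U"
      unfolding openin_product_topology_alt by force
    obtain n where n: "\<And>i. i \<in> {i. W i \<noteq> K} \<Longrightarrow> i < n"
      using finite_nat_bounded[OF W(1)] by auto
    have "y \<in> U" if y: "y \<in> UNIV \<rightarrow> K" and eq: "\<forall>i<n. y i = x i" for y
    proof -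
      have "y i \<in> W i" for i
      proof (cases "i < n")
        case True
        then show ?thesis using W(2) eq by (auto simp: PiE_UNIV_domain)
      next
        case False
        then show ?thesis using n y by fastforce
      qed
      then show ?thesis using W(3) by auto
    qed
    then show ?thesis by blast
  qed
  ultimately show ?rhs by blast
next
  assume R: ?rhs
  show "openin ?P U"
    unfolding openin_subopen[of _ U]
  proof
    fix x assume x: "x \<in> U"
    with R have "\<exists>n. \<forall>y\<in>UNIV \<rightarrow> K. (\<forall>i<n. y i = x i) \<longrightarrow> y \<in> U"
      by simp
    then obtain n where n: "\<forall>y\<in>UNIV \<rightarrow> K. (\<forall>i<n. y i = x i) \<longrightarrow> y \<in> U" ..
    define W where "W i = (if i < n then {x i} else K)" for i
    have xK: "x \<in> UNIV \<rightarrow> K" using R x by auto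
    have "finite {i \<in> UNIV. W i \<noteq> topspace (discrete_topology K)}"
      by (rule finite_subset[of _ "{..<n}"]) (auto simp: W_def)
    moreover have "\<forall>i\<in>UNIV. openin (discrete_topology K) (W i)"
      using xK by (auto simp: W_def)
    moreover have "x \<in> Pi\<^sub>E UNIV W"
      using xK by (auto simp: W_def PiE_UNIV_domain)
    moreover have "Pi\<^sub>E UNIV W \<subseteq> U"
    proof
      fix y assume "y \<in> Pi\<^sub>E UNIV W"
      then have y: "\<And>i. y i \<in> W i" by auto
      show "y \<in> U"
      proof (rule n[rule_format])
        show "y i = x i" if "i < n" for i
          using that y[of i] by (simp add: W_def)
        show "y \<in> UNIV \<rightarrow> K"
        proof
          fix i show "y i \<in> K"
            using y[of i] xK by (auto simp: W_def split: if_splits)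
        qed
      qed
    qed
    moreover have "openin ?P (Pi\<^sub>E UNIV W)"
      by (rule product_topology_basis) (use calculation in auto)
    ultimately show "\<exists>T. openin ?P T \<and> x \<in> T \<and> T \<subseteq> U"
      by blast
  qed
qed

lemma open_bool_fun_iff:
  fixes U :: "(nat \<Rightarrow> bool) set"
  shows "open U \<longleftrightarrow> (\<forall>x\<in>U. \<exists>n. \<forall>y. (\<forall>i<n. y i = x i) \<longrightarrow> y \<in> U)"
  using openin_product_discrete_iff[of "UNIV :: bool set" U]
  unfolding cantor_space_def[symmetric] cantor_space_euclidean open_openin[symmetric]
  by simp

lemma compact_UNIV_bool_fun: "compact (UNIV :: (nat \<Rightarrow> bool) set)"
proof -
  have "compact_space cantor_space"
    unfolding cantor_space_def
    by (simp add: compact_space_product_topology compact_space_discrete_topology)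
  then show ?thesis
    by (simp add: cantor_space_euclidean compact_space_def)
qed

lemma closed_imp_compact_bool_fun: "closed C \<Longrightarrow> compact C" for C :: "(nat \<Rightarrow> bool) set"
  using compact_Int_closed[OF compact_UNIV_bool_fun] by simp

lemma open_cylinder: "open {y :: nat \<Rightarrow> bool. \<forall>i<n. y i = x i}"
  unfolding open_bool_fun_iff by auto

lemma closed_bool_fun_iff:
  fixes C :: "(nat \<Rightarrow> bool) set"
  shows "closed C \<longleftrightarrow> (\<forall>x. (\<forall>n. \<exists>y\<in>C. \<forall>i<n. y i = x i) \<longrightarrow> x \<in> C)"
proof -
  have swap: "(x \<notin> C \<longrightarrow> (\<exists>n. P n)) \<longleftrightarrow> ((\<forall>n. \<not> P n) \<longrightarrow> x \<in> C)" for x and P :: "nat \<Rightarrow> bool"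
    by blast
  have bex: "\<not> (\<forall>y. Q y \<longrightarrow> y \<notin> C) \<longleftrightarrow> (\<exists>y\<in>C. Q y)" for Q :: "(nat \<Rightarrow> bool) \<Rightarrow> bool"
    by blast
  show ?thesis
    unfolding closed_def open_bool_fun_iff Ball_def Compl_iff swap bex ..
qed

text \<open>The value is unspecified for \<open>y = z\<close>, so the facts below assume
  \<open>y \<noteq> z\<close>.\<close>

definition first_diff :: "(nat \<Rightarrow> bool) \<Rightarrow> (nat \<Rightarrow> bool) \<Rightarrow> nat" where
  "first_diff y z = (LEAST k. y k \<noteq> z k)"

lemma first_diff:
  assumes "y \<noteq> z"
  shows "y (first_diff y z) \<noteq> z (first_diff y z)" "\<And>i. i < first_diff y z \<Longrightarrow> y i = z i"
proof -
  have "\<exists>k. y k \<noteq> z k" using assms by auto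
  then show "y (first_diff y z) \<noteq> z (first_diff y z)"
    unfolding first_diff_def by (rule LeastI_ex)
  show "\<And>i. i < first_diff y z \<Longrightarrow> y i = z i"
    unfolding first_diff_def using not_less_Least by blast
qed

text \<open>Only the bits up to and including the first difference matter. Hence
  \<open>first_diff\<close> is locally constant in its first argument away from
  \<open>z\<close>.\<close>

lemma first_diff_cong:
  assumes "y \<noteq> z" "\<And>i. i \<le> first_diff y z \<Longrightarrow> y' i = y i"
  shows "first_diff y' z = first_diff y z"
  unfolding first_diff_def[of y' z]
proof (rule Least_equality)
  show "y' (first_diff y z) \<noteq> z (first_diff y z)"
    using assms first_diff by auto
  fix k assume "y' k \<noteq> z k"
  then show "first_diff y z \<le> k"
    using assms first_diff(2)[OF assms(1), of k] by (metis leI less_imp_le)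
qed

lemma le_first_diff:
  assumes "y \<noteq> z" "\<And>i. i < k \<Longrightarrow> y i = z i"
  shows "k \<le> first_diff y z"
  using first_diff(1)[OF assms(1)] assms(2) by (meson not_le)

section \<open>The Hurewicz dichotomy\<close>

text \<open>The first clause is continuity into the Baire space, whose coordinates are discrete.
  Domination is required at every coordinate, not just at almost all, because each coordinate will
  control the distance to one rational.\<close>

definition dominating_map :: "(nat \<Rightarrow> bool) set \<Rightarrow> ((nat \<Rightarrow> bool) \<Rightarrow> nat \<Rightarrow> nat) \<Rightarrow> bool" where
  "dominating_map X \<Phi> \<longleftrightarrow>
     (\<forall>y\<in>X. \<forall>i. \<exists>n. \<forall>y'\<in>X. (\<forall>j<n. y' j = y j) \<longrightarrow> \<Phi> y' i = \<Phi> y i) \<and>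
     (\<forall>\<beta>. \<exists>y\<in>X. \<forall>i. \<beta> i \<le> \<Phi> y i)"

text \<open>
  A node of the Hurewicz tree is a pair \<open>p = (x, n)\<close>, standing for the basic neighbourhood of \<open>x\<close>
  given by its first \<open>n\<close> values, together with the limit point \<open>Z p\<close> outside \<open>X\<close>. The sets
  \<open>{y. first_diff y (Z p) = k}\<close> partition the complement of \<open>Z p\<close>, so every \<open>y \<in> X\<close> follows exactly
  one branch, and this branch is the value of the map at \<open>y\<close>. Infinitely many children of each node are
  genuine, and this makes the range dominating.
\<close>

lemma ex_dominating_map:
  fixes f :: "(nat \<Rightarrow> 'k) \<Rightarrow> nat \<Rightarrow> bool"
  assumes ne: "F \<noteq> {}"
    and closed: "\<And>x. (\<And>n. \<exists>x'\<in>F. \<forall>i<n. x' i = x i) \<Longrightarrow> x \<in> F"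
    and cont: "\<And>x m. x \<in> F \<Longrightarrow> \<exists>n. \<forall>x'\<in>F. (\<forall>i<n. x' i = x i) \<longrightarrow> (\<forall>i<m. f x' i = f x i)"
    and fX: "f ` F \<subseteq> X"
    and limit: "\<And>x n. x \<in> F \<Longrightarrow>
       \<exists>z. z \<notin> X \<and> (\<forall>k. \<exists>x'\<in>F. (\<forall>i<n. x' i = x i) \<and> (\<forall>i<k. f x' i = z i))"
  shows "\<exists>\<Phi>. dominating_map X \<Phi>"
proof -
  obtain Z where Z: "\<And>x n. x \<in> F \<Longrightarrow> Z (x, n) \<notin> X"
    and Zlim: "\<And>x n k. x \<in> F \<Longrightarrow> \<exists>x'\<in>F. (\<forall>i<n. x' i = x i) \<and> (\<forall>i<k. f x' i = Z (x, n) i)"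
  proof -
    have "\<forall>p. \<exists>z. fst p \<in> F \<longrightarrow> z \<notin> X \<and>
        (\<forall>k. \<exists>x'\<in>F. (\<forall>i<snd p. x' i = fst p i) \<and> (\<forall>i<k. f x' i = z i))"
      using limit by blast
    then obtain Z where "\<And>p. fst p \<in> F \<Longrightarrow> Z p \<notin> X \<and>
        (\<forall>k. \<exists>x'\<in>F. (\<forall>i<snd p. x' i = fst p i) \<and> (\<forall>i<k. f x' i = Z p i))"
      using choice[of "\<lambda>p z. fst p \<in> F \<longrightarrow> z \<notin> X \<and>
        (\<forall>k. \<exists>x'\<in>F. (\<forall>i<snd p. x' i = fst p i) \<and> (\<forall>i<k. f x' i = z i))"] by blast
    then show thesis
      by (intro that[of Z]) fastforce+
  qed
  \<comment> \<open>Here \<open>q\<close> is a genuine child of \<open>p\<close> on branch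
    \<open>k\<close>: a strictly longer neighbourhood inside that of \<open>p\<close>, on which the
    images of all points of \<open>F\<close> lie in the single piece with index
    \<open>k\<close>.\<close>
  define good where "good p k q \<longleftrightarrow> fst q \<in> F \<and> snd p < snd q \<and> (\<forall>i<snd p. fst q i = fst p i) \<and>
    (\<forall>x\<in>F. (\<forall>i<snd q. x i = fst q i) \<longrightarrow> first_diff (f x) (Z p) = k)" for p k q
  \<comment> \<open>On a branch without a genuine child the node is repeated. This makes
    \<open>state\<close> total and keeps every node based in \<open>F\<close>, so that its limit
    point stays outside \<open>X\<close>.\<close>
  define step where "step p k = (if \<exists>q. good p k q then SOME q. good p k q else p)" for p k
  have step_good: "good p k (step p k)" if "good p k q" for p k q
    using that unfolding step_def by (metis someI)
  have step_F: "fst (step p k) \<in> F" if "fst p \<in> F" for p k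
  proof (cases "\<exists>q. good p k q")
    case True
    then have "good p k (step p k)" using step_good by blast
    then show ?thesis by (simp add: good_def)
  qed (auto simp: step_def that)
  \<comment> \<open>Images of points of \<open>F\<close> near \<open>x\<close> agree with
    \<open>Z p\<close> arbitrarily far, yet differ from it since they lie in \<open>X\<close>. So
    their first difference can be made at least \<open>b\<close>, and continuity freezes it on a
    smaller neighbourhood.\<close>
  have ex_good: "\<exists>k\<ge>b. \<exists>q. good p k q" if p: "fst p \<in> F" for p b
  proof -
    obtain x n where pe: "p = (x, n)" by (cases p)
    with p have x: "x \<in> F" by simp
    obtain x' where x': "x' \<in> F" "\<And>i. i < n \<Longrightarrow> x' i = x i" "\<And>i. i < b \<Longrightarrow> f x' i = Z (x, n) i"
      using Zlim[OF x] by blast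
    have ne: "f x' \<noteq> Z (x, n)" using Z[OF x] x'(1) fX by auto
    define k where "k = first_diff (f x') (Z (x, n))"
    obtain m where m: "\<And>x''. x'' \<in> F \<Longrightarrow> \<forall>i<m. x'' i = x' i \<Longrightarrow> \<forall>i<Suc k. f x'' i = f x' i"
      using cont[OF x'(1), of "Suc k"] by blast
    \<comment> \<open>The length \<open>m\<close> freezes the first difference; \<open>Suc n\<close>
      forces the lengths to grow strictly.\<close>
    have "good p k (x', max m (Suc n))"
      unfolding good_def pe
    proof (intro conjI ballI impI)
      fix x'' assume x'': "x'' \<in> F"
        and "\<forall>i<snd (x', max m (Suc n)). x'' i = fst (x', max m (Suc n)) i"
      then have agree: "\<forall>i<m. x'' i = x' i" by simp
      have "first_diff (f x'') (Z (x, n)) = first_diff (f x') (Z (x, n))"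
        by (rule first_diff_cong[OF ne]) (use m[OF x''] agree k_def in auto)
      then show "first_diff (f x'') (Z (x, n)) = k" by (simp add: k_def)
    qed (use x' in auto)
    moreover have "b \<le> k"
      unfolding k_def using le_first_diff[OF ne] x'(3) by blast
    ultimately show ?thesis by blast
  qed
  obtain x0 where x0: "x0 \<in> F" using ne by blast
  define state where "state y = rec_nat (x0, 0) (\<lambda>_ p. step p (first_diff y (Z p)))" for y
  have state_0: "state y 0 = (x0, 0)"
    and state_Suc: "state y (Suc i) = step (state y i) (first_diff y (Z (state y i)))" for y i
    by (simp_all add: state_def)
  have state_F: "fst (state y i) \<in> F" for y i
    by (induction i) (simp_all add: state_0 state_Suc x0 step_F)
  define \<Phi> where "\<Phi> y i = first_diff y (Z (state y i))" for y i
  have ZX: "Z (state y i) \<notin> X" for y i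
    using Z state_F by (metis prod.collapse)
  \<comment> \<open>Each node on the path of \<open>y\<close> is determined by finitely many bits of
    \<open>y\<close>, because \<open>y\<close> differs from all the limit points met on the
    way.\<close>
  have loc: "\<exists>n. \<forall>y'. (\<forall>j<n. y' j = y j) \<longrightarrow> state y' i = state y i" if y: "y \<in> X" for y i
  proof (induction i)
    case 0
    then show ?case by (simp add: state_0)
  next
    case (Suc i)
    then obtain n where n: "\<And>y'. \<forall>j<n. y' j = y j \<Longrightarrow> state y' i = state y i" by blast
    have ne: "y \<noteq> Z (state y i)" using ZX y by metis
    have "state y' (Suc i) = state y (Suc i)"
      if "\<forall>j<max n (Suc (first_diff y (Z (state y i)))). y' j = y j" for y'
    proof -
      have "state y' i = state y i" by (rule n) (simp add: that)
      moreover have "first_diff y' (Z (state y i)) = first_diff y (Z (state y i))"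
        by (rule first_diff_cong[OF ne]) (simp add: that less_Suc_eq_le)
      ultimately show ?thesis by (simp add: state_Suc)
    qed
    then show ?case by blast
  qed
  have locally_constant: "\<exists>n. \<forall>y'\<in>X. (\<forall>j<n. y' j = y j) \<longrightarrow> \<Phi> y' i = \<Phi> y i" if y: "y \<in> X" for y i
  proof -
    obtain n where n: "\<And>y'. \<forall>j<n. y' j = y j \<Longrightarrow> state y' i = state y i"
      using loc[OF y] by blast
    have ne: "y \<noteq> Z (state y i)" using ZX y by metis
    have "\<Phi> y' i = \<Phi> y i" if "\<forall>j<max n (Suc (first_diff y (Z (state y i)))). y' j = y j" for y'
    proof -
      have "state y' i = state y i" by (rule n) (simp add: that)
      moreover have "first_diff y' (Z (state y i)) = first_diff y (Z (state y i))"
        by (rule first_diff_cong[OF ne]) (simp add: that less_Suc_eq_le)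
      ultimately show ?thesis by (simp add: \<Phi>_def)
    qed
    then show ?thesis by blast
  qed
  have dominating: "\<exists>y\<in>X. \<forall>i. \<beta> i \<le> \<Phi> y i" for \<beta>
  proof -
    define pick where "pick p b = (SOME k. b \<le> k \<and> (\<exists>q. good p k q))" for p and b :: nat
    have pick: "b \<le> pick p b \<and> good p (pick p b) (step p (pick p b))" if "fst p \<in> F" for p b
    proof -
      have "b \<le> pick p b \<and> (\<exists>q. good p (pick p b) q)"
        unfolding pick_def by (rule someI_ex) (use ex_good[OF that, of b] in blast)
      then show ?thesis using step_good by blast
    qed
    \<comment> \<open>A path through genuine children whose \<open>i\<close>-th branch index is at
      least \<open>\<beta> i\<close>; its limit will be the required point.\<close>
    define q where "q = rec_nat (x0, 0) (\<lambda>i p. step p (pick p (\<beta> i)))"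
    have q_0: "q 0 = (x0, 0)" and q_Suc: "q (Suc i) = step (q i) (pick (q i) (\<beta> i))" for i
      by (simp_all add: q_def)
    have qF: "fst (q i) \<in> F" for i
      by (induction i) (simp_all add: q_0 q_Suc x0 step_F)
    have q_good: "good (q i) (pick (q i) (\<beta> i)) (q (Suc i))" and q_ge: "\<beta> i \<le> pick (q i) (\<beta> i)" for i
      using pick[OF qF] by (auto simp: q_Suc)
    have sm: "strict_mono (\<lambda>i. snd (q i))"
      using q_good by (simp add: strict_mono_Suc_iff good_def)
    have agree: "fst (q j) l = fst (q i) l" if "i \<le> j" "l < snd (q i)" for i j l
      using that(1)
    proof (induction j rule: dec_induct)
      case (step j)
      have "l < snd (q j)"
        using that(2) strict_mono_less_eq[OF sm, of i j] step(1) by simp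
      then show ?case using q_good[of j] step.IH by (auto simp: good_def)
    qed simp
    \<comment> \<open>Node \<open>Suc l\<close> has length greater than \<open>l\<close>, so its
      coordinate \<open>l\<close> no longer changes along the path.\<close>
    define x where "x l = fst (q (Suc l)) l" for l
    have x_agree: "x l = fst (q i) l" if "l < snd (q i)" for i l
    proof (cases "i \<le> Suc l")
      case True
      then show ?thesis using agree that by (simp add: x_def)
    next
      case False
      have "l < snd (q (Suc l))"
        using strict_mono_imp_increasing[OF sm, of "Suc l"] by simp
      then show ?thesis using agree[of "Suc l" i l] False by (simp add: x_def)
    qed
    have "x \<in> F"
    proof (rule closed)
      fix n
      have "n \<le> snd (q n)" using strict_mono_imp_increasing[OF sm] by blast
      then have "\<forall>i<n. fst (q n) i = x i" using x_agree by (metis order_less_le_trans)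
      then show "\<exists>x'\<in>F. \<forall>i<n. x' i = x i" using qF by blast
    qed
    \<comment> \<open>The limit lies in the neighbourhood of \<open>q (Suc i)\<close>, so its image
      takes the chosen branch at stage \<open>i\<close>. Hence \<open>state (f x)\<close> retraces
      the path \<open>q\<close>.\<close>
    have fd: "first_diff (f x) (Z (q i)) = pick (q i) (\<beta> i)" for i
    proof -
      have "\<forall>l<snd (q (Suc i)). x l = fst (q (Suc i)) l"
        using x_agree by blast
      then show ?thesis
        using q_good[of i] \<open>x \<in> F\<close> unfolding good_def by blast
    qed
    have "state (f x) i = q i" for i
      by (induction i) (simp_all add: state_0 q_0 state_Suc q_Suc fd)
    then have "\<beta> i \<le> \<Phi> (f x) i" for i
      using q_ge by (simp add: \<Phi>_def fd)
    then show ?thesis using fX \<open>x \<in> F\<close> by blast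
  qed
  show ?thesis
    unfolding dominating_map_def
    by (intro exI[of _ \<Phi>] conjI ballI allI locally_constant dominating)
qed

section \<open>Cardinal bounds and coverings by few compact sets\<close>

lemma countable_iff_ordLeq_natLeq: "countable A \<longleftrightarrow> |A| \<le>o natLeq"
proof -
  have "countable A \<longleftrightarrow> |A| \<le>o |UNIV :: nat set|"
    unfolding countable_def card_of_ordLeq[symmetric] by auto
  then show ?thesis
    using card_of_nat ordIso_symmetric ordLeq_ordIso_trans by blast
qed

lemma countable_imp_ordLeq:
  assumes "countable A" "Cinfinite r"
  shows "|A| \<le>o r"
  using assms countable_iff_ordLeq_natLeq natLeq_ordLeq_cinfinite ordLeq_transitive by blast

lemma card_of_lists_length:
  assumes r: "Cinfinite r" and K: "|K| \<le>o r"
  shows "|{xs. set xs \<subseteq> K \<and> length xs = n}| \<le>o r"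
proof (induction n)
  case 0
  have "{xs. set xs \<subseteq> K \<and> length xs = 0} = {[]}" by auto
  then show ?case
    using countable_imp_ordLeq[OF _ r, of "{[]}"] by simp
next
  case (Suc n)
  let ?L = "{xs. set xs \<subseteq> K \<and> length xs = n}"
  have "{xs. set xs \<subseteq> K \<and> length xs = Suc n} \<subseteq> (\<lambda>(x, xs). x # xs) ` (K \<times> ?L)"
    by (auto simp: length_Suc_conv image_iff)
  then have "|{xs. set xs \<subseteq> K \<and> length xs = Suc n}| \<le>o |K \<times> ?L|"
    by (meson card_of_image card_of_mono1 ordLeq_transitive)
  moreover have "|K \<times> ?L| \<le>o r"
    using r K Suc by (auto intro!: card_of_Times_ordLeq_infinite_Field simp: cinfinite_def)
  ultimately show ?case
    using ordLeq_transitive by blast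
qed

lemma card_of_lists_ordLeq:
  assumes r: "Cinfinite r" and K: "|K| \<le>o r"
  shows "|lists K| \<le>o r"
proof -
  have "lists K = (\<Union>n. {xs. set xs \<subseteq> K \<and> length xs = n})"
    by auto
  moreover have "|\<Union>n. {xs. set xs \<subseteq> K \<and> length xs = n}| \<le>o r"
  proof (rule UNION_Cinfinite_bound)
    show "|UNIV :: nat set| \<le>o r"
      by (rule countable_imp_ordLeq[OF _ r]) simp
  qed (use assms card_of_lists_length in auto)
  ultimately show ?thesis by simp
qed

text \<open>For countable coverings these would be the subsets of sigma-compact subsets of
  \<open>X\<close>, the small sets of the classical Hurewicz theorem. The compact sets must lie
  inside \<open>X\<close>, since the whole Cantor space is compact.\<close>

definition compactly_coverable :: "'i rel \<Rightarrow> (nat \<Rightarrow> bool) set \<Rightarrow> (nat \<Rightarrow> bool) set \<Rightarrow> bool" where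
  "compactly_coverable r X S \<longleftrightarrow>
     (\<exists>\<C>. |\<C>| \<le>o r \<and> (\<forall>C\<in>\<C>. compact C \<and> C \<subseteq> X) \<and> S \<subseteq> \<Union>\<C>)"

lemma compactly_coverable_UN:
  assumes r: "Cinfinite r" and I: "|I| \<le>o r"
    and S: "\<And>i. i \<in> I \<Longrightarrow> compactly_coverable r X (S i)"
  shows "compactly_coverable r X (\<Union>i\<in>I. S i)"
proof -
  have "\<forall>i\<in>I. \<exists>\<C>. |\<C>| \<le>o r \<and> (\<forall>C\<in>\<C>. compact C \<and> C \<subseteq> X) \<and> S i \<subseteq> \<Union>\<C>"
    using S by (auto simp: compactly_coverable_def)
  then obtain \<C> where \<C>: "\<forall>i\<in>I. |\<C> i| \<le>o r \<and> (\<forall>C\<in>\<C> i. compact C \<and> C \<subseteq> X) \<and> S i \<subseteq> \<Union>(\<C> i)"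
    by (rule bchoice[THEN exE])
  then have card: "\<forall>i\<in>I. |\<C> i| \<le>o r"
    and cpt: "\<And>i C. i \<in> I \<Longrightarrow> C \<in> \<C> i \<Longrightarrow> compact C \<and> C \<subseteq> X"
    and cov: "\<And>i. i \<in> I \<Longrightarrow> S i \<subseteq> \<Union>(\<C> i)"
    by simp_all
  show ?thesis
    unfolding compactly_coverable_def
  proof (intro exI[of _ "\<Union>i\<in>I. \<C> i"] conjI)
    show "|\<Union>i\<in>I. \<C> i| \<le>o r"
      using I card r by (rule UNION_Cinfinite_bound)
    show "\<forall>C\<in>\<Union>i\<in>I. \<C> i. compact C \<and> C \<subseteq> X"
      using cpt by blast
    show "(\<Union>i\<in>I. S i) \<subseteq> \<Union>(\<Union>i\<in>I. \<C> i)"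
      using cov by blast
  qed
qed

lemma compactly_coverable_Un:
  assumes r: "Cinfinite r" and "compactly_coverable r X S" "compactly_coverable r X T"
  shows "compactly_coverable r X (S \<union> T)"
proof -
  have "compactly_coverable r X (\<Union>b\<in>(UNIV :: bool set). if b then S else T)"
  proof (rule compactly_coverable_UN[OF r])
    show "|UNIV :: bool set| \<le>o r"
      by (rule countable_imp_ordLeq[OF _ r]) simp
  qed (use assms in auto)
  then show ?thesis by (simp add: UNIV_bool Un_commute)
qed

lemma compactly_coverable_mono:
  "compactly_coverable r X T \<Longrightarrow> S \<subseteq> T \<Longrightarrow> compactly_coverable r X S"
  unfolding compactly_coverable_def by blast

text \<open>Removing from the domain all basic neighbourhoods with small image loses only a small
  image, as there are at most \<open>r\<close> of them. The remaining kernel \<open>F\<close> is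
  closed and nonempty, and no neighbourhood in it has small image. The closure of such an image is
  compact, so it must leave \<open>X\<close>; this yields the limit points for the Hurewicz
  tree.\<close>

lemma analytic_compactly_coverable_or_dominating:
  fixes f :: "(nat \<Rightarrow> 'k) \<Rightarrow> nat \<Rightarrow> bool"
  assumes r: "Cinfinite r" and K: "|K| \<le>o r"
    and cont: "continuous_map (product_topology (\<lambda>_. discrete_topology K) UNIV) (top_of_set X) f"
    and surj: "f ` (UNIV \<rightarrow> K) = X"
    and not_cov: "\<not> compactly_coverable r X X"
  shows "\<exists>\<Phi>. dominating_map X \<Phi>"
proof -
  let ?small = "compactly_coverable r X"
  define N where "N x n = {y \<in> UNIV \<rightarrow> K. \<forall>i<n. y i = x i}" for x :: "nat \<Rightarrow> 'k" and n :: nat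
  define F where "F = {x \<in> UNIV \<rightarrow> K. \<forall>n. \<not> ?small (f ` N x n)}"
  have N_cong: "N x n = N x' n" if "\<forall>i<n. x' i = x i" for x x' n
    using that by (auto simp: N_def)
  have small_rest: "?small (f ` ((UNIV \<rightarrow> K) - F))"
  proof -
    \<comment> \<open>Coding neighbourhoods by finite sequences bounds their number by
      \<open>|lists K|\<close>, which is at most \<open>r\<close>.\<close>
    let ?N = "\<lambda>s. N ((!) s) (length s)"
    let ?I = "{s \<in> lists K. ?small (f ` ?N s)}"
    have "|?I| \<le>o r"
      using card_of_lists_ordLeq[OF r K] card_of_mono1[of ?I "lists K"] ordLeq_transitive by blast
    then have "?small (\<Union>s\<in>?I. f ` ?N s)"
      by (rule compactly_coverable_UN[OF r]) simp
    moreover have "f ` ((UNIV \<rightarrow> K) - F) \<subseteq> (\<Union>s\<in>?I. f ` ?N s)"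
    proof
      fix y assume "y \<in> f ` ((UNIV \<rightarrow> K) - F)"
      then obtain x where x: "x \<in> UNIV \<rightarrow> K" "x \<notin> F" "y = f x" by blast
      then obtain n where n: "?small (f ` N x n)" by (auto simp: F_def)
      let ?s = "map x [0..<n]"
      have Ns: "N x n = ?N ?s" by (auto simp: N_def)
      have "?s \<in> lists K" using x(1) by (auto simp: Pi_iff)
      then have "?s \<in> ?I" using n by (simp add: Ns del: in_lists_conv_set)
      moreover have "y \<in> f ` ?N ?s"
        unfolding Ns[symmetric] x(3) using x(1) by (intro imageI) (simp add: N_def)
      ultimately show "y \<in> (\<Union>s\<in>?I. f ` ?N s)"
        by (rule UN_I)
    qed
    ultimately show ?thesis by (rule compactly_coverable_mono)
  qed
  have FK: "F \<subseteq> UNIV \<rightarrow> K" by (auto simp: F_def)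
  show ?thesis
  proof (rule ex_dominating_map[of F f X])
    show "F \<noteq> {}"
      using not_cov small_rest surj by auto
    show "f ` F \<subseteq> X"
      using FK surj by blast
    show "x \<in> F" if x: "\<And>n. \<exists>x'\<in>F. \<forall>i<n. x' i = x i" for x
    proof -
      have "x i \<in> K" for i
      proof -
        obtain x' where "x' \<in> F" "\<forall>j<Suc i. x' j = x j" using x by blast
        then have "x' i = x i" "x' \<in> UNIV \<rightarrow> K" using FK by auto
        then show ?thesis by (metis PiE UNIV_I)
      qed
      moreover have "\<not> ?small (f ` N x n)" for n
      proof -
        obtain x' where x': "x' \<in> F" "\<forall>j<n. x' j = x j" using x by blast
        then show ?thesis using N_cong[OF x'(2)] by (simp add: F_def)
      qed
      ultimately show ?thesis by (simp add: F_def)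
    qed
    show "\<exists>n. \<forall>x'\<in>F. (\<forall>i<n. x' i = x i) \<longrightarrow> (\<forall>i<m. f x' i = f x i)" if x: "x \<in> F" for x m
    proof -
      let ?U = "{x' \<in> topspace (product_topology (\<lambda>_. discrete_topology K) UNIV).
          f x' \<in> X \<inter> {y. \<forall>i<m. y i = f x i}}"
      have "openin (product_topology (\<lambda>_. discrete_topology K) UNIV) ?U"
        by (rule openin_continuous_map_preimage[OF cont]) (simp add: openin_open_Int open_cylinder)
      moreover have "x \<in> ?U"
        using x FK surj by (auto simp: PiE_UNIV_domain)
      ultimately obtain n where "\<forall>y\<in>UNIV \<rightarrow> K. (\<forall>i<n. y i = x i) \<longrightarrow> y \<in> ?U"
        unfolding openin_product_discrete_iff by meson
      then show ?thesis using FK by blast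
    qed
    show "\<exists>z. z \<notin> X \<and> (\<forall>k. \<exists>x'\<in>F. (\<forall>i<n. x' i = x i) \<and> (\<forall>i<k. f x' i = z i))"
      if x: "x \<in> F" for x n
    proof -
      \<comment> \<open>Restricting to \<open>F\<close> discards only a small part of the image, so
        \<open>?A\<close> is still not small. If its closure stayed in \<open>X\<close>, that one
        compact set would cover it.\<close>
      let ?A = "f ` (F \<inter> N x n)"
      have "\<not> ?small ?A"
      proof
        assume "?small ?A"
        then have "?small (?A \<union> f ` ((UNIV \<rightarrow> K) - F))"
          using compactly_coverable_Un[OF r] small_rest by blast
        moreover have "f ` N x n \<subseteq> ?A \<union> f ` ((UNIV \<rightarrow> K) - F)"
          by (auto simp: N_def)
        ultimately have "?small (f ` N x n)"
          by (rule compactly_coverable_mono)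
        then show False using x by (simp add: F_def)
      qed
      moreover have "?small ?A" if "closure ?A \<subseteq> X"
      proof -
        have "|{closure ?A}| \<le>o r"
          by (rule countable_imp_ordLeq[OF _ r]) simp
        moreover have "compact (closure ?A)"
          by (simp add: closed_imp_compact_bool_fun)
        ultimately show ?thesis
          unfolding compactly_coverable_def using that closure_subset[of ?A]
          by (intro exI[of _ "{closure ?A}"]) simp
      qed
      ultimately obtain z where z: "z \<in> closure ?A" "z \<notin> X" by blast
      have "\<exists>x'\<in>F. (\<forall>i<n. x' i = x i) \<and> (\<forall>i<k. f x' i = z i)" for k
      proof -
        have "{y. \<forall>i<k. y i = z i} \<inter> ?A \<noteq> {}"
          using z(1) open_Int_closure_eq_empty[OF open_cylinder[of k z], of ?A] by auto
        then show ?thesis by (auto simp: N_def)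
      qed
      then show ?thesis using z(2) by blast
    qed
  qed
qed

section \<open>Projecting onto the irrationals\<close>

text \<open>The product of \<open>M\<close> with the irrationals is a continuous image of a closed
  subset of \<open>X \<times> M \<times> \<real>\<close>, which is Lindelof because
  \<open>\<real>\<close> is sigma-compact.\<close>

lemma Lindelof_space_prod_irrationals:
  assumes dominating: "dominating_map X \<Phi>"
    and Lin: "Lindelof_space (prod_topology (top_of_set X) M)"
  shows "Lindelof_space (prod_topology M irrationals)"
proof -
  have loc: "\<exists>n. \<forall>y'\<in>X. (\<forall>j<n. y' j = y j) \<longrightarrow> \<Phi> y' i = \<Phi> y i" if "y \<in> X" for y i
    using dominating that by (simp add: dominating_map_def)
  have dom: "\<exists>y\<in>X. \<forall>i. \<beta> i \<le> \<Phi> y i" for \<beta>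
    using dominating by (simp add: dominating_map_def)
  define q :: "nat \<Rightarrow> real" where "q = from_nat_into \<rat>"
  have q: "range q = \<rat>"
    unfolding q_def using countable_rat by (intro range_from_nat_into) auto
  let ?P = "prod_topology (prod_topology (top_of_set X) M) (euclidean :: real topology)"
  \<comment> \<open>The point \<open>y\<close> certifies that the real coordinate keeps distance at
    least \<open>1 / (\<Phi> y n + 1)\<close> from the \<open>n\<close>-th rational. This is a
    closed condition, excludes all rationals, and by domination holds at each irrational for some
    \<open>y\<close>.\<close>
  define S where "S = {p \<in> topspace ?P. \<forall>n. 0 \<le> \<bar>snd p - q n\<bar> - 1 / real (Suc (\<Phi> (fst (fst p)) n))}"
  have "continuous_on X (\<lambda>y. 1 / real (Suc (\<Phi> y n)))" for n
    unfolding continuous_on_def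
  proof
    fix y assume y: "y \<in> X"
    obtain k where k: "\<And>y'. y' \<in> X \<Longrightarrow> \<forall>j<k. y' j = y j \<Longrightarrow> \<Phi> y' n = \<Phi> y n"
      using loc[OF y, of n] by blast
    have "\<forall>\<^sub>F y' in at y within X. 1 / real (Suc (\<Phi> y' n)) = 1 / real (Suc (\<Phi> y n))"
      unfolding eventually_at_topological
      by (intro exI[of _ "{y'. \<forall>j<k. y' j = y j}"] conjI open_cylinder)
        (auto dest: k)
    then show "((\<lambda>y. 1 / real (Suc (\<Phi> y n))) \<longlongrightarrow> 1 / real (Suc (\<Phi> y n))) (at y within X)"
      by (rule tendsto_eventually)
  qed
  then have cont_\<Phi>: "continuous_map (top_of_set X) euclideanreal (\<lambda>y. 1 / real (Suc (\<Phi> y n)))" for n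
    by simp
  have "closedin ?P {p \<in> topspace ?P. \<bar>snd p - q n\<bar> - 1 / real (Suc (\<Phi> (fst (fst p)) n)) \<in> {0..}}" for n
  proof (rule closedin_continuous_map_preimage)
    have "continuous_map ?P (top_of_set X) (\<lambda>p. fst (fst p))"
      using continuous_map_compose[OF continuous_map_fst continuous_map_fst] by (simp add: o_def)
    from continuous_map_compose[OF this cont_\<Phi>]
    show "continuous_map ?P euclideanreal
        (\<lambda>p. \<bar>snd p - q n\<bar> - 1 / real (Suc (\<Phi> (fst (fst p)) n)))"
      by (intro continuous_map_diff continuous_map_real_abs continuous_map_snd continuous_map_const[THEN iffD2])
        (simp_all add: o_def)
    show "closedin euclideanreal {0::real..}" by simp
  qed
  then have "closedin ?P (\<Inter>n. {p \<in> topspace ?P. \<bar>snd p - q n\<bar> - 1 / real (Suc (\<Phi> (fst (fst p)) n)) \<in> {0..}})"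
    by (intro closedin_Inter) auto
  also have "\<dots> = S"
    by (auto simp: S_def)
  finally have "closedin ?P S" .
  then have "Lindelof_space (subtopology ?P S)"
    using Lindelof_space_prod_real[OF Lin] by (rule Lindelof_space_closedin_subtopology[rotated])
  moreover have "continuous_map (subtopology ?P S) (prod_topology M irrationals) (\<lambda>p. (snd (fst p), snd p))"
    unfolding continuous_map_pairwise irrationals_def
  proof (intro conjI)
    have "continuous_map ?P M (\<lambda>p. snd (fst p))"
      using continuous_map_compose[OF continuous_map_fst continuous_map_snd] by (simp add: o_def)
    then show "continuous_map (subtopology ?P S) M (fst \<circ> (\<lambda>p. (snd (fst p), snd p)))"
      by (simp add: o_def continuous_map_from_subtopology)
    have "snd p \<notin> \<rat>" if "p \<in> S" for p
    proof
      assume "snd p \<in> \<rat>"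
      then obtain n where "snd p = q n" using q by (metis imageE)
      moreover have "0 \<le> \<bar>snd p - q n\<bar> - 1 / real (Suc (\<Phi> (fst (fst p)) n))"
        using that by (simp add: S_def)
      ultimately show False by simp
    qed
    then show "continuous_map (subtopology ?P S) (top_of_set (- \<rat>)) (snd \<circ> (\<lambda>p. (snd (fst p), snd p)))"
      by (auto simp: o_def continuous_map_in_subtopology continuous_map_from_subtopology continuous_map_snd)
  qed
  moreover have "(\<lambda>p. (snd (fst p), snd p)) ` topspace (subtopology ?P S) = topspace (prod_topology M irrationals)"
  proof
    show "topspace (prod_topology M irrationals) \<subseteq> (\<lambda>p. (snd (fst p), snd p)) ` topspace (subtopology ?P S)"
    proof
      fix p assume "p \<in> topspace (prod_topology M irrationals)"
      then obtain m x where p: "p = (m, x)" and m: "m \<in> topspace M" and x: "x \<notin> \<rat>"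
        by (auto simp: irrationals_def)
      have "\<exists>k. 1 / real (Suc k) \<le> \<bar>x - q n\<bar>" for n
      proof -
        have "x \<noteq> q n" using q x by auto
        then have "0 < \<bar>x - q n\<bar>" by simp
        from reals_Archimedean[OF this] show ?thesis
          by (metis inverse_eq_divide less_imp_le)
      qed
      then obtain \<beta> where \<beta>: "\<And>n. 1 / real (Suc (\<beta> n)) \<le> \<bar>x - q n\<bar>"
        by metis
      obtain y where y: "y \<in> X" "\<And>i. \<beta> i \<le> \<Phi> y i" using dom by blast
      have "1 / real (Suc (\<Phi> y n)) \<le> \<bar>x - q n\<bar>" for n
      proof -
        have "1 / real (Suc (\<Phi> y n)) \<le> 1 / real (Suc (\<beta> n))"
          using y(2)[of n] by (simp add: frac_le)
        then show ?thesis using \<beta>[of n] by linarith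
      qed
      then have "((y, m), x) \<in> topspace (subtopology ?P S)"
        using y(1) m by (simp add: S_def)
      then show "p \<in> (\<lambda>p. (snd (fst p), snd p)) ` topspace (subtopology ?P S)"
        using p by (metis (no_types, lifting) fst_conv image_iff snd_conv)
    qed
  qed (use calculation(2) continuous_map_image_subset_topspace in blast)
  ultimately show ?thesis
    by (rule Lindelof_space_continuous_map_image)
qed

section \<open>Covering compact sets\<close>

text \<open>
  The retraction copies the bits of its argument as long as they lead to a node of the tree of \<open>L\<close>, and
  flips the other bits. It maps every basic open set onto a relatively open subset of \<open>L\<close>, hence
  pulls nowhere dense closed subsets of \<open>L\<close> back to nowhere dense sets.
\<close>

lemma closed_retraction:
  fixes L :: "(nat \<Rightarrow> bool) set"
  assumes L: "closed L" "L \<noteq> {}"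
  obtains h :: "(nat \<Rightarrow> bool) \<Rightarrow> nat \<Rightarrow> bool"
  where "\<And>\<alpha>. h \<alpha> \<in> L"
    and "\<And>\<alpha> \<alpha>' n. \<forall>i<n. \<alpha>' i = \<alpha> i \<Longrightarrow> \<forall>i<n. h \<alpha>' i = h \<alpha> i"
    and "\<And>\<alpha> n x. x \<in> L \<Longrightarrow> \<forall>i<n. x i = h \<alpha> i \<Longrightarrow> \<exists>\<alpha>'. (\<forall>i<n. \<alpha>' i = \<alpha> i) \<and> h \<alpha>' = x"
proof -
  \<comment> \<open>The first \<open>n\<close> bits of \<open>p\<close> followed by \<open>b\<close>
    form a node of the tree of \<open>L\<close>.\<close>
  define ext where "ext p n b \<longleftrightarrow> (\<exists>x\<in>L. (\<forall>i<n. x i = p i) \<and> x n = b)"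
    for p :: "nat \<Rightarrow> bool" and n b
  \<comment> \<open>Stage \<open>n\<close> has decided the bits below \<open>n\<close>; the value
    \<open>False\<close> merely fills the undecided positions.\<close>
  define pre where "pre \<alpha> = rec_nat (\<lambda>_. False)
      (\<lambda>n p. p(n := (if ext p n (\<alpha> n) then \<alpha> n else \<not> \<alpha> n)))" for \<alpha>
  have pre_0: "pre \<alpha> 0 = (\<lambda>_. False)"
    and pre_Suc: "pre \<alpha> (Suc n) = (pre \<alpha> n)(n := (if ext (pre \<alpha> n) n (\<alpha> n) then \<alpha> n else \<not> \<alpha> n))"
    for \<alpha> n
    by (simp_all add: pre_def)
  define h where "h \<alpha> n = pre \<alpha> (Suc n) n" for \<alpha> n
  have pre_h: "pre \<alpha> n i = h \<alpha> i" if "i < n" for \<alpha> n i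
    using Suc_leI[OF that]
  proof (induction n rule: dec_induct)
    case base
    then show ?case by (simp add: h_def)
  next
    case (step n)
    then show ?case by (simp add: pre_Suc)
  qed
  \<comment> \<open>Each decided prefix extends to a point of \<open>L\<close>. If the bit of
    \<open>\<alpha>\<close> leads out of the tree, the opposite bit must therefore stay in
    it.\<close>
  have inv: "\<exists>x\<in>L. \<forall>i<n. x i = pre \<alpha> n i" for \<alpha> n
  proof (induction n)
    case 0
    then show ?case using L(2) by auto
  next
    case (Suc n)
    show ?case
    proof (cases "ext (pre \<alpha> n) n (\<alpha> n)")
      case True
      then obtain x where "x \<in> L" "\<forall>i<n. x i = pre \<alpha> n i" "x n = \<alpha> n"
        unfolding ext_def by blast
      then show ?thesis
        using True by (intro bexI[of _ x]) (simp_all add: pre_Suc less_Suc_eq)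
    next
      case False
      from Suc obtain x where x: "x \<in> L" "\<forall>i<n. x i = pre \<alpha> n i" by blast
      with False have "x n \<noteq> \<alpha> n"
        unfolding ext_def by blast
      with x False show ?thesis
        by (intro bexI[of _ x]) (simp_all add: pre_Suc less_Suc_eq)
    qed
  qed
  have "h \<alpha> \<in> L" for \<alpha>
  proof -
    have "\<exists>x\<in>L. \<forall>i<n. x i = h \<alpha> i" for n
      using inv[of n \<alpha>] by (simp add: pre_h cong: conj_cong)
    then show ?thesis
      using L(1) unfolding closed_bool_fun_iff by blast
  qed
  moreover have pre_cong: "pre \<alpha>' n = pre \<alpha> n" if "\<forall>i<n. \<alpha>' i = \<alpha> i" for \<alpha> \<alpha>' n
    using that by (induction n) (simp_all add: pre_0 pre_Suc)
  have "\<forall>i<n. h \<alpha>' i = h \<alpha> i" if "\<forall>i<n. \<alpha>' i = \<alpha> i" for \<alpha> \<alpha>' n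
    using pre_cong[OF that] by (metis pre_h)
  moreover have "\<exists>\<alpha>'. (\<forall>i<n. \<alpha>' i = \<alpha> i) \<and> h \<alpha>' = x"
    if x: "x \<in> L" "\<forall>i<n. x i = h \<alpha> i" for \<alpha> n x
  proof -
    \<comment> \<open>From \<open>n\<close> on the argument copies \<open>x\<close>, whose prefixes
      are all in the tree, so nothing is flipped there; below \<open>n\<close> it keeps
      \<open>\<alpha>\<close>, which already produces the bits of \<open>x\<close>.\<close>
    define \<alpha>' where "\<alpha>' i = (if i < n then \<alpha> i else x i)" for i
    have 1: "pre \<alpha>' n = pre \<alpha> n"
      by (rule pre_cong) (simp add: \<alpha>'_def)
    have "h \<alpha>' i = x i" for i
    proof (induction i rule: less_induct)
      case (less i)
      show ?case
      proof (cases "i < n")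
        case True
        then show ?thesis using 1 x(2) by (metis pre_h)
      next
        case False
        have "\<forall>j<i. x j = pre \<alpha>' i j"
          using less by (simp add: pre_h)
        moreover have "x i = \<alpha>' i"
          using False by (simp add: \<alpha>'_def)
        ultimately have "ext (pre \<alpha>' i) i (\<alpha>' i)"
          unfolding ext_def using x(1) by blast
        then show ?thesis
          using False by (simp add: h_def pre_Suc) (simp add: \<alpha>'_def)
      qed
    qed
    then show ?thesis
      by (intro exI[of _ \<alpha>']) (auto simp: \<alpha>'_def)
  qed
  ultimately show thesis by (rule that)
qed

text \<open>If \<open>L\<close> has no countable subcover, delete the cylinders on which it has one.
  The closed kernel \<open>L0\<close> is nonempty, and each member of \<open>\<C>\<close> is nowhere
  dense in it. The preimages under the retraction onto \<open>L0\<close> are then at most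
  \<open>r\<close> nowhere dense sets covering the Cantor space.\<close>

lemma compact_countable_subcover:
  fixes \<C> :: "(nat \<Rightarrow> bool) set set"
  assumes cov: "\<And>F :: (nat \<Rightarrow> bool) set set.
      (\<forall>A\<in>F. meager_in cantor_space A) \<Longrightarrow> |F| \<le>o r \<Longrightarrow> \<Union>F \<noteq> topspace cantor_space"
    and card: "|\<C>| \<le>o r"
    and closed: "\<And>C. C \<in> \<C> \<Longrightarrow> closed C"
    and L: "closed L" "L \<subseteq> \<Union>\<C>"
  obtains \<D> where "\<D> \<subseteq> \<C>" "countable \<D>" "L \<subseteq> \<Union>\<D>"
proof (rule ccontr)
  define ctbl where "ctbl S \<longleftrightarrow> (\<exists>\<D>\<subseteq>\<C>. countable \<D> \<and> S \<subseteq> \<Union>\<D>)" for S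
  assume "\<not> thesis"
  then have L_not: "\<not> ctbl L" using that unfolding ctbl_def by blast
  have ctbl_UN: "ctbl (\<Union>i\<in>I. S i)" if I: "countable I" and S: "\<And>i. i \<in> I \<Longrightarrow> ctbl (S i)"
    for I :: "bool list set" and S
  proof -
    have "\<forall>i\<in>I. \<exists>\<D>. \<D> \<subseteq> \<C> \<and> countable \<D> \<and> S i \<subseteq> \<Union>\<D>"
      using S unfolding ctbl_def by blast
    then obtain \<D> where "\<forall>i\<in>I. \<D> i \<subseteq> \<C> \<and> countable (\<D> i) \<and> S i \<subseteq> \<Union>(\<D> i)"
      by (rule bchoice[THEN exE])
    then show ?thesis
      unfolding ctbl_def using I by (intro exI[of _ "\<Union>i\<in>I. \<D> i"]) fastforce
  qed
  have ctbl_Un: "ctbl (S \<union> T)" if "ctbl S" "ctbl T" for S T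
  proof -
    from that obtain \<D> \<E> where "\<D> \<subseteq> \<C>" "countable \<D>" "S \<subseteq> \<Union>\<D>" "\<E> \<subseteq> \<C>" "countable \<E>" "T \<subseteq> \<Union>\<E>"
      unfolding ctbl_def by blast
    then show ?thesis
      unfolding ctbl_def by (intro exI[of _ "\<D> \<union> \<E>"]) auto
  qed
  have ctbl_mono: "ctbl S" if "ctbl T" "S \<subseteq> T" for S T
    using that unfolding ctbl_def by blast
  define cyl where "cyl s = {y :: nat \<Rightarrow> bool. \<forall>i<length s. y i = s ! i}" for s
  define I where "I = {s. ctbl (L \<inter> cyl s)}"
  define L0 where "L0 = L - (\<Union>s\<in>I. cyl s)"
  have "ctbl (\<Union>s\<in>I. L \<inter> cyl s)"
    by (rule ctbl_UN) (auto simp: I_def)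
  then have rest: "ctbl (L - L0)"
    by (rule ctbl_mono) (auto simp: L0_def)
  have "closed L0"
  proof -
    have "open (cyl s)" for s
      unfolding cyl_def by (rule open_cylinder)
    then show ?thesis
      unfolding L0_def using L(1) by blast
  qed
  moreover have "L0 \<noteq> {}"
    using rest L_not by auto
  ultimately obtain h :: "(nat \<Rightarrow> bool) \<Rightarrow> nat \<Rightarrow> bool" where hL: "\<And>\<alpha>. h \<alpha> \<in> L0"
    and h_cong: "\<And>\<alpha> \<alpha>' n. \<forall>i<n. \<alpha>' i = \<alpha> i \<Longrightarrow> \<forall>i<n. h \<alpha>' i = h \<alpha> i"
    and h_surj: "\<And>\<alpha> n x. x \<in> L0 \<Longrightarrow> \<forall>i<n. x i = h \<alpha> i \<Longrightarrow> \<exists>\<alpha>'. (\<forall>i<n. \<alpha>' i = \<alpha> i) \<and> h \<alpha>' = x"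
  proof (rule closed_retraction, goal_cases)
    case (1 h)
    show ?case by (rule 1(1)[of h]) (fact 1)+
  qed
  have nwd: "nowhere_dense_in cantor_space (h -` C)" if C: "C \<in> \<C>" for C
  proof -
    have "closed (h -` C)"
      unfolding closed_bool_fun_iff
    proof (intro allI impI)
      fix \<alpha> assume \<alpha>: "\<forall>n. \<exists>\<beta>\<in>h -` C. \<forall>i<n. \<beta> i = \<alpha> i"
      have "\<exists>y\<in>C. \<forall>i<n. y i = h \<alpha> i" for n
      proof -
        obtain \<beta> where \<beta>: "h \<beta> \<in> C" "\<forall>i<n. \<beta> i = \<alpha> i" using \<alpha> by blast
        show ?thesis using h_cong[OF \<beta>(2)] \<beta>(1) by (rule bexI)
      qed
      moreover have "(\<forall>n. \<exists>y\<in>C. \<forall>i<n. y i = h \<alpha> i) \<longrightarrow> h \<alpha> \<in> C"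
        using closed[OF C] unfolding closed_bool_fun_iff by (rule spec)
      ultimately show "\<alpha> \<in> h -` C" by simp
    qed
    moreover have "interior (h -` C) = {}"
    proof (rule ccontr)
      assume "interior (h -` C) \<noteq> {}"
      then obtain \<alpha> where "\<alpha> \<in> interior (h -` C)" by blast
      moreover have "\<forall>\<alpha>\<in>interior (h -` C). \<exists>n. \<forall>\<beta>. (\<forall>i<n. \<beta> i = \<alpha> i) \<longrightarrow> \<beta> \<in> interior (h -` C)"
        using open_interior[of "h -` C"] unfolding open_bool_fun_iff .
      ultimately obtain n where "\<forall>\<beta>. (\<forall>i<n. \<beta> i = \<alpha> i) \<longrightarrow> \<beta> \<in> interior (h -` C)"
        by (elim bspec[elim_format] exE)
      then have n: "h \<beta> \<in> C" if "\<forall>i<n. \<beta> i = \<alpha> i" for \<beta>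
        using that interior_subset[of "h -` C"] by blast
      \<comment> \<open>By \<open>h_surj\<close> the cylinder around \<open>\<alpha>\<close> maps
        onto \<open>L0 \<inter> cyl ?s\<close>, so this piece would lie in the single set
        \<open>C\<close>. Together with the countably covered \<open>L - L0\<close> this puts
        \<open>?s\<close> into \<open>I\<close>, although \<open>h \<alpha>\<close> survived in
        \<open>L0\<close>.\<close>
      let ?s = "map (h \<alpha>) [0..<n]"
      have "L0 \<inter> cyl ?s \<subseteq> C"
      proof
        fix x assume x: "x \<in> L0 \<inter> cyl ?s"
        then have "\<forall>i<n. x i = h \<alpha> i" by (simp add: cyl_def)
        from h_surj[OF IntD1[OF x] this] obtain \<beta> where "\<forall>i<n. \<beta> i = \<alpha> i" "h \<beta> = x"
          by (elim exE conjE)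
        then show "x \<in> C" using n[of \<beta>] by simp
      qed
      moreover have "ctbl C"
        unfolding ctbl_def using C by (intro exI[of _ "{C}"]) simp
      ultimately have "ctbl (L0 \<inter> cyl ?s)" using ctbl_mono by blast
      then have "ctbl (L0 \<inter> cyl ?s \<union> (L - L0))" using rest ctbl_Un by blast
      then have "ctbl (L \<inter> cyl ?s)" by (rule ctbl_mono) blast
      then have "?s \<in> I" by (simp add: I_def)
      moreover have "h \<alpha> \<in> cyl ?s" by (simp add: cyl_def)
      ultimately show False using hL[of \<alpha>] unfolding L0_def by blast
    qed
    ultimately show ?thesis
      by (simp add: nowhere_dense_in_def cantor_space_euclidean)
  qed
  have "\<Union>((\<lambda>C. h -` C) ` \<C>) \<noteq> topspace cantor_space"
  proof (rule cov)
    show "|(\<lambda>C. h -` C) ` \<C>| \<le>o r"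
      using card card_of_image ordLeq_transitive by blast
    show "\<forall>A\<in>(\<lambda>C. h -` C) ` \<C>. meager_in cantor_space A"
    proof
      fix A assume "A \<in> (\<lambda>C. h -` C) ` \<C>"
      then have "nowhere_dense_in cantor_space A" using nwd by blast
      then show "meager_in cantor_space A"
        unfolding meager_in_def by (auto simp: nowhere_dense_in_def intro!: exI[of _ "\<lambda>_::nat. A"])
    qed
  qed
  moreover have "\<alpha> \<in> \<Union>((\<lambda>C. h -` C) ` \<C>)" for \<alpha>
    using hL[of \<alpha>] L(2) by (auto simp: L0_def)
  ultimately show False
    by (auto simp: cantor_space_euclidean)
qed

section \<open>Concentrated sets\<close>

lemma ex_concentrated_subset:
  assumes card: "|\<C>| \<le>o cardSuc natLeq"
    and not_ctbl: "\<And>\<D>. \<D> \<subseteq> \<C> \<Longrightarrow> countable \<D> \<Longrightarrow> \<not> \<Union>\<C> \<subseteq> \<Union>\<D>"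
  obtains S where "S \<subseteq> \<Union>\<C>" "uncountable S" "\<And>C. C \<in> \<C> \<Longrightarrow> countable (S \<inter> C)"
proof -
  define below where "below C = {D \<in> \<C>. (D, C) \<in> |\<C>| }" for C
  have total: "(C, D) \<in> |\<C>| \<or> (D, C) \<in> |\<C>|" if "C \<in> \<C>" "D \<in> \<C>" for C D
    using card_of_Well_order[of \<C>] that
    unfolding well_order_on_def linear_order_on_def partial_order_on_def preorder_on_def
      total_on_def refl_on_def Field_card_of by metis
  have below: "countable (below C)" if C: "C \<in> \<C>" for C
  proof -
    have "|underS |\<C>| C| <o |\<C>|"
      using card_of_underS[OF card_of_Card_order] C by (simp add: Field_card_of)
    then have "|underS |\<C>| C| <o cardSuc natLeq"
      using card ordLess_ordLeq_trans by blast
    then have "|underS |\<C>| C| \<le>o natLeq"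
      using cardSuc_ordLeq_ordLess[OF natLeq_Card_order card_of_Card_order] by blast
    then have "countable (insert C (underS |\<C>| C))"
      unfolding countable_iff_ordLeq_natLeq[symmetric] by simp
    then show ?thesis
      by (rule countable_subset[rotated]) (auto simp: below_def underS_def)
  qed
  have "\<not> \<Union>\<C> \<subseteq> \<Union>(below C)" if "C \<in> \<C>" for C
    by (rule not_ctbl[OF _ below[OF that]]) (auto simp: below_def)
  then have "\<forall>C\<in>\<C>. \<exists>x. x \<in> \<Union>\<C> \<and> x \<notin> \<Union>(below C)"
    by blast
  then obtain x where x: "\<And>C. C \<in> \<C> \<Longrightarrow> x C \<in> \<Union>\<C>" "\<And>C. C \<in> \<C> \<Longrightarrow> x C \<notin> \<Union>(below C)"
    by metis
  have hit: "{D \<in> \<C>. x D \<in> C} \<subseteq> below C" if C: "C \<in> \<C>" for C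
  proof
    fix D assume D: "D \<in> {D \<in> \<C>. x D \<in> C}"
    then have "(C, D) \<notin> |\<C>|" using x(2)[of D] C by (auto simp: below_def)
    then show "D \<in> below C" using D total[OF C] by (auto simp: below_def)
  qed
  show thesis
  proof
    show "x ` \<C> \<subseteq> \<Union>\<C>" using x(1) by blast
    show "countable (x ` \<C> \<inter> C)" if C: "C \<in> \<C>" for C
    proof (rule countable_subset)
      show "x ` \<C> \<inter> C \<subseteq> x ` below C" using hit[OF C] by blast
      show "countable (x ` below C)" using below[OF C] by simp
    qed
    show "uncountable (x ` \<C>)"
    proof
      assume "countable (x ` \<C>)"
      \<comment> \<open>A point may be chosen repeatedly, but only at stages below some
        \<open>C\<close> that contains it. So countably many points would make \<open>\<C>\<close>
        itself countable.\<close>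
      moreover have "countable {D \<in> \<C>. x D = y}" if y: "y \<in> x ` \<C>" for y
      proof -
        obtain C where C: "C \<in> \<C>" "y \<in> C" using y x(1) by blast
        then have "{D \<in> \<C>. x D = y} \<subseteq> below C" using hit by blast
        then show ?thesis using below[OF C(1)] countable_subset by blast
      qed
      ultimately have "countable (\<Union>y\<in>x ` \<C>. {D \<in> \<C>. x D = y})"
        by (rule countable_UN)
      moreover have "(\<Union>y\<in>x ` \<C>. {D \<in> \<C>. x D = y}) = \<C>" by blast
      ultimately show False using not_ctbl[of \<C>] by simp
    qed
  qed
qed

text \<open>This is a variant of the Michael line: isolating \<open>S\<close> creates an uncountable
  closed discrete diagonal, while concentration of \<open>S\<close> around \<open>- X\<close>
  preserves the Lindelof property.\<close>

lemma concentrated_imp_not_productive: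
  fixes X S :: "(nat \<Rightarrow> bool) set"
  assumes S: "S \<subseteq> X" "uncountable S"
    and conc: "\<And>L. closed L \<Longrightarrow> L \<subseteq> X \<Longrightarrow> countable (S \<inter> L)"
  obtains Y :: "(nat \<Rightarrow> bool) topology"
  where "Lindelof_space Y" "\<not> Lindelof_space (prod_topology (top_of_set X) Y)"
proof -
  define A where "A = - X \<union> S"
  define op where "op U \<longleftrightarrow> U \<subseteq> A \<and> (\<forall>x\<in>U - S. \<exists>V. open V \<and> x \<in> V \<and> V \<inter> A \<subseteq> U)" for U
  define Y where "Y = topology op"
  have "istopology op"
    unfolding istopology_def
  proof (intro conjI allI impI)
    fix U V assume U: "op U" and V: "op V"
    show "op (U \<inter> V)"
      unfolding op_def
    proof (intro conjI ballI)
      show "U \<inter> V \<subseteq> A" using U by (auto simp: op_def)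
      fix x assume x: "x \<in> U \<inter> V - S"
      then obtain U' V' where "open U'" "x \<in> U'" "U' \<inter> A \<subseteq> U" "open V'" "x \<in> V'" "V' \<inter> A \<subseteq> V"
        using U V unfolding op_def by blast
      then show "\<exists>W. open W \<and> x \<in> W \<and> W \<inter> A \<subseteq> U \<inter> V"
        by (intro exI[of _ "U' \<inter> V'"]) auto
    qed
  next
    fix \<K> assume \<K>: "\<forall>K\<in>\<K>. op K"
    show "op (\<Union>\<K>)"
      unfolding op_def
    proof (intro conjI ballI)
      show "\<Union>\<K> \<subseteq> A" using \<K> by (auto simp: op_def)
      fix x assume "x \<in> \<Union>\<K> - S"
      then obtain K where K: "K \<in> \<K>" "x \<in> K - S" by blast
      then have "\<forall>x\<in>K - S. \<exists>V. open V \<and> x \<in> V \<and> V \<inter> A \<subseteq> K"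
        using \<K> by (simp add: op_def)
      then obtain V where "open V" "x \<in> V" "V \<inter> A \<subseteq> K"
        using K(2) by (elim bspec[elim_format] exE conjE)
      then show "\<exists>V. open V \<and> x \<in> V \<and> V \<inter> A \<subseteq> \<Union>\<K>"
        using K(1) by (intro exI[of _ V]) auto
    qed
  qed
  then have openY: "openin Y = op"
    unfolding Y_def by (rule topology_inverse')
  have "op A" by (auto simp: op_def)
  then have topY: "topspace Y = A"
    unfolding topspace_def openY by (metis (mono_tags) Sup_upper Union_least mem_Collect_eq op_def subset_antisym)
  have "Lindelof_space Y"
    unfolding Lindelof_space_alt topY openY
  proof (intro allI impI)
    fix \<U> assume "(\<forall>U\<in>\<U>. op U) \<and> A \<subseteq> \<Union>\<U>"
    then have \<U>: "\<And>U. U \<in> \<U> \<Longrightarrow> op U" "A \<subseteq> \<Union>\<U>" by auto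
    \<comment> \<open>These Cantor-open sets have traces on \<open>A\<close> inside single members
      of the cover, and second countability reduces them to countably many.\<close>
    define \<V> where "\<V> = {V. open V \<and> (\<exists>U\<in>\<U>. V \<inter> A \<subseteq> U)}"
    have "\<And>V. V \<in> \<V> \<Longrightarrow> open V" by (simp add: \<V>_def)
    then obtain \<V>' where \<V>': "\<V>' \<subseteq> \<V>" "countable \<V>'" "\<Union>\<V>' = \<Union>\<V>"
      using Lindelof[of \<V>] by metis
    have "\<forall>V\<in>\<V>'. \<exists>U. U \<in> \<U> \<and> V \<inter> A \<subseteq> U"
      using \<V>'(1) unfolding \<V>_def by blast
    then obtain u where u: "\<And>V. V \<in> \<V>' \<Longrightarrow> u V \<in> \<U>" "\<And>V. V \<in> \<V>' \<Longrightarrow> V \<inter> A \<subseteq> u V"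
      by metis
    have "- X \<subseteq> \<Union>\<V>"
    proof
      fix x assume x: "x \<in> - X"
      then have "x \<in> \<Union>\<U>" "x \<notin> S" using \<U>(2) S(1) by (auto simp: A_def)
      then obtain U where U: "U \<in> \<U>" "x \<in> U - S" by blast
      have "\<forall>x\<in>U - S. \<exists>V. open V \<and> x \<in> V \<and> V \<inter> A \<subseteq> U"
        using \<U>(1)[OF U(1)] by (simp add: op_def)
      then obtain V where "open V" "x \<in> V" "V \<inter> A \<subseteq> U"
        using U(2) by (elim bspec[elim_format] exE conjE)
      then show "x \<in> \<Union>\<V>" using U(1) unfolding \<V>_def by blast
    qed
    \<comment> \<open>What \<open>\<Union>\<V>\<close> misses is a closed subset of
      \<open>X\<close>, so only countably many isolated points remain to be covered one by
      one.\<close>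
    moreover have "closed (- \<Union>\<V>)"
      by (intro closed_Compl open_Union) (simp add: \<V>_def)
    ultimately have "countable (S \<inter> - \<Union>\<V>)"
      by (intro conc) auto
    moreover have "\<forall>s\<in>S. \<exists>U. U \<in> \<U> \<and> s \<in> U"
      using \<U>(2) by (auto simp: A_def)
    then obtain v where v: "\<And>s. s \<in> S \<Longrightarrow> v s \<in> \<U>" "\<And>s. s \<in> S \<Longrightarrow> s \<in> v s"
      by metis
    ultimately have "countable (u ` \<V>' \<union> v ` (S \<inter> - \<Union>\<V>))"
      using \<V>'(2) by auto
    moreover have "u ` \<V>' \<union> v ` (S \<inter> - \<Union>\<V>) \<subseteq> \<U>"
      using u(1) v(1) by blast
    moreover have "A \<subseteq> \<Union>(u ` \<V>' \<union> v ` (S \<inter> - \<Union>\<V>))"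
    proof
      fix a assume a: "a \<in> A"
      show "a \<in> \<Union>(u ` \<V>' \<union> v ` (S \<inter> - \<Union>\<V>))"
      proof (cases "a \<in> \<Union>\<V>")
        case True
        then obtain V where "V \<in> \<V>'" "a \<in> V" using \<V>'(3) by blast
        then show ?thesis using u(2) a by blast
      next
        case False
        then have "a \<in> S \<inter> - \<Union>\<V>" using a \<open>- X \<subseteq> \<Union>\<V>\<close> by (auto simp: A_def)
        then show ?thesis using v(2) by blast
      qed
    qed
    ultimately show "\<exists>\<W>. countable \<W> \<and> \<W> \<subseteq> \<U> \<and> A \<subseteq> \<Union>\<W>" by blast
  qed
  moreover have "\<not> Lindelof_space (prod_topology (top_of_set X) Y)"
  proof
    let ?P = "prod_topology (top_of_set X) Y"
    let ?\<Delta> = "{p \<in> topspace ?P. fst p = snd p}"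
    assume Lin: "Lindelof_space ?P"
    \<comment> \<open>The topology of \<open>Y\<close> refines that of the Cantor space, so the
      diagonal is the set where two continuous maps into a Hausdorff space agree.\<close>
    have "continuous_map Y euclidean (\<lambda>x. x)"
      unfolding continuous_map_def
    proof (intro conjI allI impI)
      fix U :: "(nat \<Rightarrow> bool) set" assume "openin euclidean U"
      then have "open U" by simp
      then show "openin Y {x \<in> topspace Y. x \<in> U}"
        unfolding openY topY op_def by auto
    qed simp
    then have "continuous_map ?P euclidean snd"
      using continuous_map_compose[OF continuous_map_snd] by (fastforce simp: o_def)
    moreover have "continuous_map ?P euclidean fst"
      using continuous_map_fst continuous_map_into_fulltopology by blast
    ultimately have "closedin ?P ?\<Delta>"
      using Hausdorff_cantor_space closedin_continuous_maps_eq unfolding cantor_space_euclidean by blast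
    then have "Lindelof_space (subtopology ?P ?\<Delta>)"
      using Lin Lindelof_space_closedin_subtopology by blast
    then have Lin\<Delta>: "\<exists>\<V>. countable \<V> \<and> \<V> \<subseteq> \<U> \<and> ?\<Delta> \<subseteq> \<Union>\<V>"
      if "\<forall>U\<in>\<U>. openin ?P U" "?\<Delta> \<subseteq> \<Union>\<U>" for \<U>
      using that Lindelof_space_subtopology_subset[of ?\<Delta> ?P] by simp
    have \<Delta>: "?\<Delta> = (\<lambda>s. (s, s)) ` S"
      using S(1) by (auto simp: topY A_def)
    \<comment> \<open>Each open set \<open>X \<times> {s}\<close> meets the diagonal in one point,
      so a countable subcover would make \<open>S\<close> countable.\<close>
    have "\<exists>\<V>. countable \<V> \<and> \<V> \<subseteq> (\<lambda>s. X \<times> {s}) ` S \<and> ?\<Delta> \<subseteq> \<Union>\<V>"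
    proof (rule Lin\<Delta>)
      have "openin Y {s}" if "s \<in> S" for s
        using that by (simp add: openY op_def A_def)
      then show "\<forall>U\<in>(\<lambda>s. X \<times> {s}) ` S. openin ?P U"
        by (auto simp: openin_prod_Times_iff)
      show "?\<Delta> \<subseteq> \<Union>((\<lambda>s. X \<times> {s}) ` S)"
        unfolding \<Delta> using S(1) by auto
    qed
    then obtain T where T: "countable T" "T \<subseteq> S" "?\<Delta> \<subseteq> \<Union>((\<lambda>s. X \<times> {s}) ` T)"
      unfolding ex_countable_subset_image by (elim exE conjE)
    have "S \<subseteq> T" using T(3) unfolding \<Delta> by auto
    then show False using T(1) S(2) countable_subset by blast
  qed
  ultimately show thesis by (rule that)
qed

section \<open>From the dichotomy and the covering argument to sigma-compactness\<close>

text \<open>On a finite type \<open>M\<close> would be compact, and its product with the Lindelof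
  space of irrationals would be Lindelof. Infinity of \<open>'m\<close> provides room in
  \<open>'m set\<close> for a copy of the Cantor space.\<close>

lemma Michael_space_infinite_UNIV:
  fixes M :: "'m topology"
  assumes "Michael_space M"
  shows "infinite (UNIV :: 'm set)"
proof
  assume "finite (UNIV :: 'm set)"
  then have "compact_space M"
    unfolding compact_space_def
    by (intro finite_imp_compactin subset_refl) (rule rev_finite_subset[OF _ subset_UNIV])
  moreover have "Lindelof_space irrationals"
    unfolding irrationals_def Lindelof_space_subtopology
  proof (intro allI impI)
    fix \<U> :: "real set set"
    assume \<U>: "(\<forall>U\<in>\<U>. openin euclidean U) \<and> topspace euclidean \<inter> - \<rat> \<subseteq> \<Union>\<U>"
    then have "\<And>U. U \<in> \<U> \<Longrightarrow> open U" by simp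
    then obtain \<V> where "\<V> \<subseteq> \<U>" "countable \<V>" "\<Union>\<V> = \<Union>\<U>"
      by (rule Lindelof)
    then show "\<exists>\<V>. countable \<V> \<and> \<V> \<subseteq> \<U> \<and> topspace euclidean \<inter> - \<rat> \<subseteq> \<Union>\<V>"
      using \<U> by (intro exI[of _ \<V>]) simp
  qed
  ultimately have "Lindelof_space (prod_topology irrationals M)"
    using Lindelof_space_prod_compact by blast
  then have "Lindelof_space (prod_topology M irrationals)"
    using homeomorphic_Lindelof_space homeomorphic_space_prod_topology_swap by blast
  then show False using assms by (simp add: Michael_space_def)
qed

theorem theorem5p7:
  fixes M :: "'m topology"
  assumes cov: "\<And>F :: (nat \<Rightarrow> bool) set set.
                   (\<forall>A\<in>F. meager_in cantor_space A) \<Longrightarrow> ordLeq3 (card_of F) aleph1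
                   \<Longrightarrow> \<Union>F \<noteq> topspace cantor_space"
      and michael: "Michael_space M"
  shows "\<forall>X. X \<subseteq> topspace cantor_space
            \<and> productively_Lindelof TYPE('m set) (subtopology cantor_space X)
            \<and> aleph1_analytic TYPE('k) (subtopology cantor_space X)
            \<longrightarrow> sigma_compact_in cantor_space X"
proof (intro allI impI, elim conjE)
  fix X :: "(nat \<Rightarrow> bool) set"
  assume pL: "productively_Lindelof TYPE('m set) (subtopology cantor_space X)"
    and an: "aleph1_analytic TYPE('k) (subtopology cantor_space X)"
  note prodL = productively_Lindelof_prod[OF pL[unfolded cantor_space_euclidean]]
  have r: "Cinfinite aleph1"
    by (simp add: Cinfinite_cardSuc natLeq_Cinfinite)
  obtain K :: "'k set" where K: "|K| =o aleph1"
    and via: "kappa_analytic_via K (top_of_set X)"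
    using an unfolding aleph1_analytic_def cantor_space_euclidean by (elim exE conjE)
  from via have "\<exists>f :: (nat \<Rightarrow> 'k) \<Rightarrow> nat \<Rightarrow> bool. continuous_map (product_topology (\<lambda>_. discrete_topology K) UNIV) (top_of_set X) f \<and>
      f ` topspace (product_topology (\<lambda>_. discrete_topology K) UNIV) = topspace (top_of_set X)"
    unfolding kappa_analytic_via_def by (rule conjunct2)
  then obtain f :: "(nat \<Rightarrow> 'k) \<Rightarrow> nat \<Rightarrow> bool" where f: "continuous_map (product_topology (\<lambda>_. discrete_topology K) UNIV) (top_of_set X) f \<and>
      f ` topspace (product_topology (\<lambda>_. discrete_topology K) UNIV) = topspace (top_of_set X)" ..
  have K_le: "|K| \<le>o aleph1" using K by (rule ordIso_imp_ordLeq)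
  have surj: "f ` (UNIV \<rightarrow> K) = X" using f by (simp add: PiE_UNIV_domain)
  have "compactly_coverable aleph1 X X"
  proof (rule ccontr)
    assume "\<not> compactly_coverable aleph1 X X"
    from analytic_compactly_coverable_or_dominating[OF r K_le conjunct1[OF f] surj this]
    obtain \<Phi> where \<Phi>: "dominating_map X \<Phi>" ..
    \<comment> \<open>Singletons embed \<open>M\<close> into the type \<open>'m set\<close> of the
      test spaces.\<close>
    have "Lindelof_space (prod_topology (top_of_set X) M)"
      by (rule prodL[of M "\<lambda>m. {m}"]) (use michael in \<open>auto simp: Michael_space_def\<close>)
    with \<Phi> have "Lindelof_space (prod_topology M irrationals)"
      by (rule Lindelof_space_prod_irrationals)
    then show False using michael by (simp add: Michael_space_def)
  qed
  then obtain \<C> where \<C>: "|\<C>| \<le>o aleph1" "\<And>C. C \<in> \<C> \<Longrightarrow> compact C" "\<Union>\<C> = X"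
    unfolding compactly_coverable_def by (meson Sup_le_iff subset_antisym)
  have closed_\<C>: "closed C" if "C \<in> \<C>" for C
    using \<C>(2)[OF that] compactin_imp_closedin[OF Hausdorff_cantor_space, of C]
    by (simp add: cantor_space_euclidean)
  have "\<exists>\<D>. \<D> \<subseteq> \<C> \<and> countable \<D> \<and> X \<subseteq> \<Union>\<D>"
  proof (rule ccontr)
    assume no: "\<nexists>\<D>. \<D> \<subseteq> \<C> \<and> countable \<D> \<and> X \<subseteq> \<Union>\<D>"
    obtain S where S: "S \<subseteq> X" "uncountable S" "\<And>C. C \<in> \<C> \<Longrightarrow> countable (S \<inter> C)"
      using ex_concentrated_subset[OF \<C>(1)] no unfolding \<C>(3) by metis
    have conc: "countable (S \<inter> L)" if L: "closed L" "L \<subseteq> X" for L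
    proof -
      obtain \<D> where \<D>: "\<D> \<subseteq> \<C>" "countable \<D>" "L \<subseteq> \<Union>\<D>"
        using compact_countable_subcover[OF cov \<C>(1) closed_\<C> L(1)] L(2) \<C>(3) by blast
      have "countable (\<Union>C\<in>\<D>. S \<inter> C)"
        using \<D>(1,2) S(3) by (intro countable_UN) auto
      then show ?thesis
        by (rule countable_subset[rotated]) (use \<D>(3) in blast)
    qed
    obtain Y :: "(nat \<Rightarrow> bool) topology"
      where Y: "Lindelof_space Y" "\<not> Lindelof_space (prod_topology (top_of_set X) Y)"
      by (rule concentrated_imp_not_productive[OF S(1,2) conc])
    \<comment> \<open>The test spaces live on \<open>'m set\<close>, which must be large enough to hold a copy of the Cantor space.\<close>
    obtain e :: "nat \<Rightarrow> 'm" where e: "inj e"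
      using Michael_space_infinite_UNIV[OF michael] infinite_countable_subset by blast
    have "inj (\<lambda>y. e ` {n. y n})"
    proof (rule injI)
      fix y z assume "e ` {n. y n} = e ` {n. z n}"
      then have "{n. y n} = {n. z n}" by (simp only: inj_image_eq_iff[OF e])
      then show "y = z" by (simp add: set_eq_iff fun_eq_iff)
    qed
    then have "Lindelof_space (prod_topology (top_of_set X) Y)"
      using prodL[OF Y(1)] inj_on_subset by blast
    then show False using Y(2) by blast
  qed
  then obtain \<D> where \<D>: "\<D> \<subseteq> \<C>" "countable \<D>" "X \<subseteq> \<Union>\<D>" by blast
  show "sigma_compact_in cantor_space X"
    unfolding sigma_compact_in_def
  proof (intro exI[of _ "from_nat_into (insert {} \<D>)"] conjI allI)
    \<comment> \<open>Adding the empty set keeps the enumerated family nonempty, even if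
      \<open>\<D>\<close> is empty, without changing its union.\<close>
    have range: "range (from_nat_into (insert {} \<D>)) = insert {} \<D>"
      using \<D>(2) by (intro range_from_nat_into) auto
    show "X = (\<Union>n. from_nat_into (insert {} \<D>) n)"
      unfolding range using \<D> \<C>(3) by auto
    show "compactin cantor_space (from_nat_into (insert {} \<D>) n)" for n
      using from_nat_into[of "insert {} \<D>" n] \<D>(1) \<C>(2) by (auto simp: cantor_space_euclidean)
  qed
qed

end
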